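(* Let $a_1,\dots,a_N\in\mathbb{R}^2\simeq\mathbb{C}$ be pairwise distinct points and let $d_1,\dots,d_N\in\mathbb{R}\setminus\{0\}$. If the configuration $(a_1,d_1,\dots,a_N,d_N)$ is in equilibrium, i.e. $\nabla W(a_1,d_1,\dots,a_N,d_N)=0$, then $$\lim_{\varepsilon\to 0^+} A_\varepsilon(a_1,d_1,\dots,a_N,d_N)=0.$$
   Context: Identify $\mathbb{R}^2$ with $\mathbb{C}$ via $z=x+iy$. For pairwise distinct vortex positions $a_j\in\mathbb{R}^2$ and circulations $d_j\in\mathbb{R}\setminus\{0\}$ ($j=1,\dots,N$), the Kirchhoff-Onsager functional is $$W(a_1,d_1,\dots,a_N,d_N)=\sum_{j\neq k} d_jd_k\log\frac{1}{|a_j-a_k|},$$ where the sum is over ordered pairs $(j,k)$ with $j\ne k$. Its gradient is taken with respect to the positions only, with the $d_j$ fixed: $\nabla W=\left(\frac{\partial W}{\partial a_1},\dots,\frac{\partial W}{\partial a_N}\right)\in\mathbb{R}^{2N}$. The configuration is in equilibrium if $\nabla W=0$. For $\varepsilon>0$, with $B_\varepsilon(a)$ the disk of radius $\varepsilon$ centred at $a$, define $$A_\varepsilon(a_1,d_1,\dots,a_N,d_N)=\int_{\mathbb{R}^2\setminus\bigcup_{\ell=1}^N B_\varepsilon(a_\ell)}\left(\left|\sum_{j=1}^N\frac{d_j}{z-a_j}\right|^4-\sum_{j=1}^N\frac{d_j^4}{|z-a_j|^4}\right)dx\,dy.$$ The limit of $A_\varepsilon$ as $\varepsilon\to0$ is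 called the correlation coefficient $A$ of the configuration. *)

theory Defs
  imports "HOL-Analysis.Analysis"
begin

text \<open>
  A configuration of \<open>N = CARD('n)\<close> vortices is a position vector \<open>a :: complex ^ 'n\<close> together with
  a circulation vector \<open>d :: real ^ 'n\<close>. The real inner product on \<open>complex ^ 'n\<close> is the
  Euclidean one on the real vector space of dimension \<open>2 N\<close>.
\<close>

definition kirchhoff_onsager :: "complex ^ 'n \<Rightarrow> real ^ 'n \<Rightarrow> real" where
  "kirchhoff_onsager a d =
     (\<Sum>(j, k) \<in> {(j, k). j \<noteq> k}. d $ j * d $ k * ln (1 / norm (a $ j - a $ k)))"

text \<open>
  The gradient is with respect to all positions jointly, with \<open>d\<close> fixed. The function is smooth
  near a configuration of pairwise distinct points, so there the library gradient exists and
  is the vector of partial derivatives.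
\<close>

definition in_equilibrium :: "complex ^ 'n \<Rightarrow> real ^ 'n \<Rightarrow> bool" where
  "in_equilibrium a d \<longleftrightarrow> (GDERIV (\<lambda>b. kirchhoff_onsager b d) a :> 0)"

text \<open>
  For pairwise distinct positions and \<open>\<epsilon> > 0\<close> the integrand is bounded on the domain and decays
  like the inverse fourth power of \<open>norm z\<close>, so the Lebesgue integral is a genuine
  (absolutely convergent) one.
\<close>

definition correlation_integral :: "real \<Rightarrow> complex ^ 'n \<Rightarrow> real ^ 'n \<Rightarrow> real" where
  "correlation_integral \<epsilon> a d =
     (LINT z : (UNIV - (\<Union>l. ball (a $ l) \<epsilon>)) | lborel.
        norm (\<Sum>j\<in>UNIV. complex_of_real (d $ j) / (z - a $ j)) ^ 4
        - (\<Sum>j\<in>UNIV. (d $ j) ^ 4 / norm (z - a $ j) ^ 4))"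

end

theory Submission
  imports Defs
begin

text \<open>
  Put \<open>f z = (\<Sum>j. d j / (z - a j))\<close>. By partial fractions, the coefficient of
  \<open>1 / (z - a j)\<close> in \<open>f\<^sup>2\<close> is
  \<open>2 * d j * (\<Sum>k\<noteq>j. d k / (a j - a k))\<close>, which is a multiple of the conjugate of
  \<open>\<partial>W/\<partial>a j\<close>. In equilibrium therefore
  \<open>f\<^sup>2 = (\<Sum>j. (d j)\<^sup>2 / (z - a j)\<^sup>2)\<close>, and expanding
  \<open>\<bar>f\<bar>^4 = \<bar>f\<^sup>2\<bar>\<^sup>2\<close> reduces the claim to the vanishing of the principal
  value of \<open>\<integral> 1 / ((z - a)\<^sup>2 * cnj (z - b)\<^sup>2)\<close> for \<open>a \<noteq> b\<close>. The
  substitution \<open>z = a + (b - a) / w\<close> sends \<open>a\<close> to infinity and turns this integral into that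
  of \<open>1 / cnj (1 - w)\<^sup>2\<close>, up to a factor, over a region that is almost an annulus around
  \<open>1\<close>. Over an exact annulus the integral is zero, because a quarter turn about \<open>1\<close> changes
  the sign of the integrand; the error lives on two annuli whose ratio of radii tends to \<open>1\<close>.
\<close>

section \<open>Area-preserving identification of the complex plane with
  \<open>real ^ 2\<close>\<close>

subsection \<open>Change of variables in the complex plane\<close>

text \<open>The determinant form of the change of variables theorem is stated on
  \<open>real ^ 'n\<close>; this map and its inverse \<open>vec_of_complex\<close> carry it over to
  \<open>complex\<close>.\<close>

definition complex_of_vec :: "real ^ 2 \<Rightarrow> complex" where
  "complex_of_vec v = Complex (v $ 1) (v $ 2)"

definition vec_of_complex :: "complex \<Rightarrow> real ^ 2" where
  "vec_of_complex z = vector [Re z, Im z]"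

lemma vec_of_complex_nth [simp]:
  "vec_of_complex z $ 1 = Re z" "vec_of_complex z $ 2 = Im z"
  by (simp_all add: vec_of_complex_def)

lemma complex_of_vec_sel [simp]:
  "Re (complex_of_vec v) = v $ 1" "Im (complex_of_vec v) = v $ 2"
  by (simp_all add: complex_of_vec_def)

lemma vec_of_complex_inverse [simp]: "complex_of_vec (vec_of_complex z) = z"
  by (simp add: complex_eq_iff)

lemma complex_of_vec_inverse [simp]: "vec_of_complex (complex_of_vec v) = v"
  by (simp add: vec_eq_iff forall_2)

lemma bounded_linear_complex_of_vec: "bounded_linear complex_of_vec"
  by (intro linear_conv_bounded_linear[THEN iffD1] linearI) (simp_all add: complex_eq_iff)

lemma bounded_linear_vec_of_complex: "bounded_linear vec_of_complex"
  by (intro linear_conv_bounded_linear[THEN iffD1] linearI) (simp_all add: vec_eq_iff forall_2)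

lemma measurable_complex_of_vec [measurable]: "complex_of_vec \<in> borel_measurable borel"
  by (intro borel_measurable_continuous_onI linear_continuous_on bounded_linear_complex_of_vec)

lemma measurable_vec_of_complex [measurable]: "vec_of_complex \<in> borel_measurable borel"
  by (intro borel_measurable_continuous_onI linear_continuous_on bounded_linear_vec_of_complex)

text \<open>Lebesgue measure is determined by its values on boxes, and the preimage of a box is the
  box with the same side lengths.\<close>

lemma lborel_complex_eq: "lborel = distr lborel borel complex_of_vec"
proof (rule lborel_eqI)
  fix l u :: complex
  assume le: "\<And>b. b \<in> Basis \<Longrightarrow> l \<bullet> b \<le> u \<bullet> b"
  have eq: "complex_of_vec -` box l u = box (vec_of_complex l) (vec_of_complex u)"
    by (auto simp: box_def Basis_complex_def Basis_vec_def axis_def inner_vec_def UNIV_2)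
  have le': "vec_of_complex l \<bullet> b \<le> vec_of_complex u \<bullet> b" if "b \<in> Basis" for b
    using that le[of 1] le[of \<i>]
    by (auto simp: Basis_complex_def Basis_vec_def inner_axis UNIV_2)
  have B: "(Basis :: (real ^ 2) set) = {axis 1 1, axis 2 1}"
    by (auto simp: Basis_vec_def UNIV_2)
  show "emeasure (distr lborel borel complex_of_vec) (box l u) = ennreal (\<Prod>b\<in>Basis. (u - l) \<bullet> b)"
    using emeasure_lborel_box[OF le']
    by (simp add: emeasure_distr eq B Basis_complex_def inner_axis axis_eq_axis)
qed simp

lemma lborel_vec_eq: "lborel = distr lborel borel vec_of_complex"
  by (subst lborel_complex_eq) (simp add: distr_distr comp_def distr_id2)

text \<open>Absolute integrability refers to the completed measure \<open>lebesgue\<close>. A map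
  that preserves \<open>lborel\<close> pulls Borel null sets back to null sets, so it stays
  measurable and measure-preserving on the completions.\<close>

lemma lebesgue_distr:
  fixes T :: "'a::euclidean_space \<Rightarrow> 'b::euclidean_space"
  assumes [measurable]: "T \<in> borel_measurable borel" and eq: "lborel = distr lborel borel T"
  shows "T \<in> lebesgue \<rightarrow>\<^sub>M lebesgue" "lebesgue = distr lebesgue lebesgue T"
proof -
  have 1: "T \<in> lebesgue \<rightarrow>\<^sub>M lborel"
    by (intro measurable_completion) (simp add: assms(1))
  have 2: "distr lebesgue lborel T = lborel"
    by (subst distr_completion) (auto simp: eq[symmetric] cong: distr_cong)
  show "lebesgue = distr lebesgue lebesgue T"
    using completion.completion_distr_eq[OF 1] by (simp add: 2)
  show "T \<in> lebesgue \<rightarrow>\<^sub>M lebesgue"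
    using completion.measurable_completion2[OF 1] by (simp add: 2)
qed

lemma absolutely_integrable_distr:
  fixes T :: "'a::euclidean_space \<Rightarrow> 'b::euclidean_space" and f :: "'b \<Rightarrow> 'c::euclidean_space"
  assumes "T \<in> borel_measurable borel" and "lborel = distr lborel borel T"
    and f: "f absolutely_integrable_on S"
  shows "(\<lambda>x. f (T x)) absolutely_integrable_on (T -` S)"
    and "integral (T -` S) (\<lambda>x. f (T x)) = integral S f"
proof -
  note T = lebesgue_distr[OF assms(1,2)]
  have ind: "indicator (T -` S) x *\<^sub>R f (T x) = indicator S (T x) *\<^sub>R f (T x)" for x
    by (simp add: indicator_def)
  have fi: "integrable lebesgue (\<lambda>x. indicator S x *\<^sub>R f x)"
    using f by (simp add: set_integrable_def)
  show 1: "(\<lambda>x. f (T x)) absolutely_integrable_on (T -` S)"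
    unfolding set_integrable_def ind
    by (rule integrable_distr[OF T(1)]) (simp add: fi T(2)[symmetric])
  show "integral (T -` S) (\<lambda>x. f (T x)) = integral S f"
    unfolding set_lebesgue_integral_eq_integral(2)[OF 1, symmetric]
      set_lebesgue_integral_eq_integral(2)[OF f, symmetric]
    unfolding set_lebesgue_integral_def ind
    using integral_distr[OF T(1) borel_measurable_integrable[OF fi]]
    by (simp add: T(2)[symmetric])
qed

text \<open>The domain is transported by invariance of the measure, the values by linearity of the
  integral. Integrability and value are kept together to match the form of the change of variables
  theorem.\<close>

lemma absolutely_integrable_complex_iff_vec:
  fixes f :: "complex \<Rightarrow> complex"
  shows "f absolutely_integrable_on S \<and> integral S f = b \<longleftrightarrow>
    (\<lambda>v. vec_of_complex (f (complex_of_vec v))) absolutely_integrable_on (complex_of_vec -` S) \<and>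
    integral (complex_of_vec -` S) (\<lambda>v. vec_of_complex (f (complex_of_vec v))) = vec_of_complex b"
    (is "?L \<longleftrightarrow> ?R1 \<and> ?R2")
proof
  assume L: ?L
  let ?g = "\<lambda>v. f (complex_of_vec v)"
  have 1: "?g absolutely_integrable_on (complex_of_vec -` S)"
    "integral (complex_of_vec -` S) ?g = b"
    using absolutely_integrable_distr[OF measurable_complex_of_vec lborel_complex_eq] L by auto
  show "?R1 \<and> ?R2"
    using absolutely_integrable_linear[OF 1(1) bounded_linear_vec_of_complex] 1
      integral_linear[OF set_lebesgue_integral_eq_integral(1)[OF 1(1)] bounded_linear_vec_of_complex]
    by (simp add: comp_def)
next
  assume R: "?R1 \<and> ?R2"
  have eq: "vec_of_complex -` complex_of_vec -` S = S"
    by auto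
  have 1: "(\<lambda>z. vec_of_complex (f z)) absolutely_integrable_on S"
    "integral S (\<lambda>z. vec_of_complex (f z)) = vec_of_complex b"
    using absolutely_integrable_distr[OF measurable_vec_of_complex lborel_vec_eq conjunct1[OF R]] R
    by (auto simp: eq)
  show ?L
    using absolutely_integrable_linear[OF 1(1) bounded_linear_complex_of_vec] 1
      integral_linear[OF set_lebesgue_integral_eq_integral(1)[OF 1(1)] bounded_linear_complex_of_vec]
    by (simp add: comp_def)
qed

text \<open>The real derivative of \<open>g\<close> is multiplication by \<open>g' z\<close>, a
  rotation combined with a scaling, and its determinant is \<open>(norm (g' z))\<close>
  squared.\<close>

lemma has_absolute_integral_change_of_variables_complex:
  fixes f g g' :: "complex \<Rightarrow> complex"
  assumes S: "S \<in> sets lebesgue"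
    and der: "\<And>z. z \<in> S \<Longrightarrow> (g has_field_derivative g' z) (at z within S)"
    and inj: "inj_on g S"
  shows "(\<lambda>z. (norm (g' z))\<^sup>2 *\<^sub>R f (g z)) absolutely_integrable_on S \<and>
         integral S (\<lambda>z. (norm (g' z))\<^sup>2 *\<^sub>R f (g z)) = b \<longleftrightarrow>
         f absolutely_integrable_on g ` S \<and> integral (g ` S) f = b"
proof -
  let ?S = "complex_of_vec -` S"
  define G where "G = (\<lambda>v. vec_of_complex (g (complex_of_vec v)))"
  define G' where "G' = (\<lambda>v h. vec_of_complex (g' (complex_of_vec v) * complex_of_vec h))"
  have S': "?S \<in> sets lebesgue"
    using measurable_sets[OF lebesgue_distr(1)[OF measurable_complex_of_vec lborel_complex_eq] S] by simp
  have im: "complex_of_vec ` ?S = S"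
    by (metis surjI surj_image_vimage_eq vec_of_complex_inverse)
  have der': "(G has_derivative G' v) (at v within ?S)" if "v \<in> ?S" for v
  proof -
    have "(g has_derivative (*) (g' (complex_of_vec v))) (at (complex_of_vec v) within complex_of_vec ` ?S)"
      unfolding im using der[of "complex_of_vec v"] that by (simp add: has_field_derivative_def)
    from has_derivative_in_compose[OF
        bounded_linear.has_derivative[OF bounded_linear_complex_of_vec has_derivative_ident] this]
    show ?thesis
      unfolding G_def G'_def
      by (rule bounded_linear.has_derivative[OF bounded_linear_vec_of_complex])
  qed
  have inj': "inj_on G ?S"
    using inj unfolding inj_on_def G_def
    by (metis complex_of_vec_inverse vec_of_complex_inverse vimageE)
  have "vec_of_complex ` X = complex_of_vec -` X" for X
    by (auto intro: rev_image_eqI)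
  then have imG: "G ` ?S = complex_of_vec -` (g ` S)"
    by (metis (no_types) G_def im image_cong image_image)
  have det: "\<bar>det (matrix (G' v))\<bar> = (norm (g' (complex_of_vec v)))\<^sup>2" for v
    by (simp add: det_2 matrix_def G'_def axis_def cmod_def power2_eq_square)
  let ?F = "\<lambda>v. vec_of_complex (f (complex_of_vec v))"
  have lin: "vec_of_complex (c *\<^sub>R w) = c *\<^sub>R vec_of_complex w" for c w
    by (rule linear_scale[OF bounded_linear.linear[OF bounded_linear_vec_of_complex]])
  have eq: "vec_of_complex ((norm (g' (complex_of_vec v)))\<^sup>2 *\<^sub>R f (g (complex_of_vec v))) =
      \<bar>det (matrix (G' v))\<bar> *\<^sub>R ?F (G v)" for v
    unfolding det lin by (simp add: G_def)
  show ?thesis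
    unfolding absolutely_integrable_complex_iff_vec eq imG[symmetric]
    by (rule has_absolute_integral_change_of_variables[OF S' der' inj'])
qed

section \<open>The two-vortex integral: cancellation on annuli, inversion, the remaining
  disks\<close>

subsection \<open>The principal value of a single interaction\<close>

text \<open>Extended by zero, the two integrands differ only on the symmetric difference of the
  domains, where the difference is \<open>f\<close> up to sign and is dominated by the sum of the
  \<open>B i\<close> times the indicators of the \<open>A i\<close>. This is the tool for replacing
  a domain by a nearby one.\<close>

lemma norm_integral_diff_le:
  fixes f :: "'a::euclidean_space \<Rightarrow> 'b::euclidean_space"
  assumes S: "f absolutely_integrable_on S" and T: "f absolutely_integrable_on T"
    and fin: "finite I" and A: "\<And>i. i \<in> I \<Longrightarrow> A i \<in> lmeasurable"
    and B: "\<And>i x. i \<in> I \<Longrightarrow> x \<in> A i \<Longrightarrow> norm (f x) \<le> B i" "\<And>i. i \<in> I \<Longrightarrow> 0 \<le> B i"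
    and sub: "(S - T) \<union> (T - S) \<subseteq> (\<Union>i\<in>I. A i)"
  shows "norm (integral S f - integral T f) \<le> (\<Sum>i\<in>I. B i * measure lebesgue (A i))"
proof -
  let ?f = "\<lambda>S x. if x \<in> S then f x else 0"
  have int: "?f S integrable_on UNIV" "?f T integrable_on UNIV"
    using S T by (simp_all add: absolutely_integrable_on_def integrable_restrict_UNIV)
  have ind: "((\<lambda>x. B i * indicator (A i) x) has_integral B i * measure lebesgue (A i)) UNIV"
    if "i \<in> I" for i
    using lmeasurable_iff_has_integral[THEN iffD1, OF A[OF that]] by (rule has_integral_mult_right)
  have "integral S f - integral T f = integral UNIV (\<lambda>x. ?f S x - ?f T x)"
    by (simp only: integral_diff[OF int] integral_restrict_UNIV)
  also have "norm \<dots> \<le> integral UNIV (\<lambda>x. \<Sum>i\<in>I. B i * indicator (A i) x)"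
  proof (rule integral_norm_bound_integral)
    show "(\<lambda>x. ?f S x - ?f T x) integrable_on UNIV"
      by (intro integrable_diff int)
    show "(\<lambda>x. \<Sum>i\<in>I. B i * indicator (A i) x) integrable_on UNIV"
      using ind fin by (intro integrable_sum) blast+
    show "norm (?f S x - ?f T x) \<le> (\<Sum>i\<in>I. B i * indicator (A i) x)" for x
    proof (cases "x \<in> (S - T) \<union> (T - S)")
      case True
      then obtain i where i: "i \<in> I" "x \<in> A i"
        using sub by blast
      have "norm (?f S x - ?f T x) \<le> B i * indicator (A i) x"
        using True i B(1) by auto
      also have "\<dots> \<le> (\<Sum>i\<in>I. B i * indicator (A i) x)"
        by (rule member_le_sum) (use i B(2) fin in auto)
      finally show ?thesis .
    next
      case False
      then show ?thesis
        using B(2) by (auto intro!: sum_nonneg)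
    qed
  qed
  also have "\<dots> = (\<Sum>i\<in>I. B i * measure lebesgue (A i))"
    by (intro integral_unique has_integral_sum fin ind)
  finally show ?thesis .
qed

lemma borel_measurable_cnj [measurable]: "cnj \<in> borel_measurable borel"
  by (intro borel_measurable_continuous_onI continuous_intros)

lemma absolutely_integrable_inverse_cnj_square:
  assumes "bounded S" "S \<in> sets lebesgue" "0 < r" "\<And>w. w \<in> S \<Longrightarrow> r \<le> dist p w"
  shows "(\<lambda>w::complex. 1 / (cnj (p - w))\<^sup>2) absolutely_integrable_on S"
proof (rule measurable_bounded_by_integrable_imp_absolutely_integrable)
  show "(\<lambda>w. 1 / (cnj (p - w))\<^sup>2) \<in> borel_measurable (lebesgue_on S)"
    by (intro measurable_restrict_space1 measurable_completion) (unfold complex_cnj_diff, measurable)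
  show "(\<lambda>_. 1 / r\<^sup>2) integrable_on S"
    using assms by (intro integrable_on_const bounded_set_imp_lmeasurable)
  show "norm (1 / (cnj (p - w))\<^sup>2) \<le> 1 / r\<^sup>2" if "w \<in> S" for w
    using assms(3) assms(4)[OF that]
    by (auto simp: norm_divide norm_power dist_norm simp flip: complex_cnj_diff intro!: frac_le power_mono)
qed (fact assms)

text \<open>The quarter turn \<open>g\<close> about \<open>p\<close> preserves area and the annulus
  and multiplies \<open>p - w\<close> by \<open>\<i>\<close>, so the integral equals its own
  negative.\<close>

lemma integral_annulus_inverse_cnj_square:
  assumes "0 < r"
  shows "integral {w. r \<le> dist p w \<and> dist p w \<le> R} (\<lambda>w::complex. 1 / (cnj (p - w))\<^sup>2) = 0"
proof -
  let ?S = "{w. r \<le> dist p w \<and> dist p w \<le> R}" and ?K = "\<lambda>w::complex. 1 / (cnj (p - w))\<^sup>2"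
  define g where "g = (\<lambda>w. p + \<i> * (w - p))"
  have S: "?S = cball p R - ball p r"
    by auto
  have leb: "?S \<in> sets lebesgue"
    unfolding S by auto
  have ai: "?K absolutely_integrable_on ?S"
    using assms leb by (intro absolutely_integrable_inverse_cnj_square[of _ r]) (auto simp: S intro: bounded_diff)
  have dist: "dist p (g w) = dist p w" for w
    by (simp add: g_def dist_norm norm_mult norm_minus_commute)
  have im: "g ` ?S = ?S"
  proof (intro equalityI subsetI)
    fix w assume "w \<in> ?S"
    moreover have "w = g (p - \<i> * (w - p))"
      by (simp add: g_def)
    ultimately show "w \<in> g ` ?S"
      by (metis (mono_tags, lifting) dist image_eqI mem_Collect_eq)
  qed (auto simp: dist)
  have K: "(norm \<i>)\<^sup>2 *\<^sub>R ?K (g w) = - ?K w" for w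
    by (simp add: g_def power2_eq_square) (simp add: divide_simps algebra_simps)
  have "(g has_field_derivative \<i>) (at w within ?S)" for w
    unfolding g_def by (auto intro!: derivative_eq_intros)
  moreover have "inj_on g ?S"
    by (auto simp: inj_on_def g_def)
  ultimately have "integral ?S (\<lambda>w. (norm \<i>)\<^sup>2 *\<^sub>R ?K (g w)) = integral ?S ?K"
    using has_absolute_integral_change_of_variables_complex[OF leb, of g "\<lambda>_. \<i>" ?K "integral ?S ?K"] ai
    unfolding im by auto
  then have "- integral ?S ?K = integral ?S ?K"
    unfolding K by simp
  then show ?thesis
    by simp
qed

lemma measure_annulus:
  assumes "0 \<le> r" "r \<le> R"
  shows "{w::complex. r \<le> dist p w \<and> dist p w \<le> R} \<in> lmeasurable"
    and "measure lebesgue {w::complex. r \<le> dist p w \<and> dist p w \<le> R} = pi * (R\<^sup>2 - r\<^sup>2)"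
proof -
  have S: "{w. r \<le> dist p w \<and> dist p w \<le> R} = cball p R - ball p r"
    by auto
  show "{w::complex. r \<le> dist p w \<and> dist p w \<le> R} \<in> lmeasurable"
    unfolding S by (intro fmeasurable.Diff) auto
  have "measure lebesgue (cball p R - ball p r) = measure lebesgue (cball p R) - measure lebesgue (ball p r)"
    using assms by (intro measurable_measure_Diff) auto
  also have "\<dots> = pi * (R\<^sup>2 - r\<^sup>2)"
    using assms by (simp add: content_ball content_cball unit_ball_vol_2 algebra_simps)
  finally show "measure lebesgue {w::complex. r \<le> dist p w \<and> dist p w \<le> R} = pi * (R\<^sup>2 - r\<^sup>2)"
    unfolding S .
qed

text \<open>\<open>T\<close> is the plane without the two disks, seen in the coordinate
  \<open>w = (b - a) / (z - a)\<close> with \<open>e = \<epsilon> / norm (b - a)\<close>. The disk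
  about \<open>a\<close> becomes \<open>norm w > 1 / e\<close>, the disk about \<open>b\<close>
  becomes \<open>dist 1 w < e * norm w\<close>. For small \<open>e\<close> this is close to the
  annulus \<open>e \<le> dist 1 w \<le> 1 / e\<close>, on which the integral vanishes.\<close>

lemma norm_integral_inverse_cnj_square_le:
  fixes e :: real
  assumes e: "0 < e" "e < 1"
  defines "T \<equiv> {w. norm w \<le> 1 / e \<and> e * norm w \<le> dist 1 w}"
  shows "(\<lambda>w::complex. 1 / (cnj (1 - w))\<^sup>2) absolutely_integrable_on T" (is "?K absolutely_integrable_on T")
    and "norm (integral T (\<lambda>w::complex. 1 / (cnj (1 - w))\<^sup>2))
      \<le> pi * (1 / (1 - e) ^ 4 - 1) + pi * (((1 + e) / (1 - e))\<^sup>2 - 1)"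
proof -
  have closed: "closed T"
    unfolding T_def by (intro closed_Collect_conj closed_Collect_le continuous_intros)
  have tri: "1 \<le> norm w + dist 1 w" "dist 1 w \<le> 1 + norm w" "norm w \<le> 1 + dist 1 w" for w :: complex
    using norm_triangle_ineq[of "w" "1 - w"] norm_triangle_ineq4[of 1 w] norm_triangle_ineq4[of 1 "1 - w"]
    by (simp_all add: dist_norm)
  show K: "?K absolutely_integrable_on T"
  proof (rule absolutely_integrable_inverse_cnj_square[of _ "e / 2"])
    show "bounded T"
      unfolding bounded_iff T_def by auto
    \<comment> \<open>Either \<open>norm w \<le> 1 / 2\<close>, and then \<open>w\<close> is at
      distance at least \<open>1 / 2\<close> from \<open>1\<close>, or the second condition in
      \<open>T\<close> gives at least \<open>e / 2\<close>.\<close>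
    show "e / 2 \<le> dist 1 w" if "w \<in> T" for w
    proof (cases "norm w \<le> 1 / 2")
      case True
      then show ?thesis
        using tri(1)[of w] e by linarith
    next
      case False
      then have "e * (1 / 2) \<le> e * norm w"
        using e by (intro mult_left_mono) auto
      then show ?thesis
        using that unfolding T_def by auto
    qed
  qed (use closed e in auto)
  define Q where "Q = (\<lambda>r R. {w::complex. r \<le> dist 1 w \<and> dist 1 w \<le> R})"
  \<comment> \<open>The annulus for \<open>True\<close> contains the error at the inner boundary:
    the curve \<open>dist 1 w = e * norm w\<close> stays between distances
    \<open>e / (1 + e)\<close> and \<open>e / (1 - e)\<close> from \<open>1\<close>, and
    \<open>e * (1 - e)\<close> is a simpler lower bound. The annulus for \<open>False\<close>
    contains the error at the outer circle, whose centre is \<open>0\<close> instead of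
    \<open>1\<close>.\<close>
  define r where "r = (\<lambda>b. if b then e * (1 - e) else 1 / e - 1)"
  define R where "R = (\<lambda>b. if b then e / (1 - e) else 1 / e + 1)"
  have rR: "0 < r b" "r b \<le> R b" for b
  proof -
    show "0 < r b"
      using e by (auto simp: r_def)
    have "e * (1 - e) \<le> e * 1" "e / 1 \<le> e / (1 - e)"
      using e by (intro mult_left_mono divide_left_mono; simp)+
    then show "r b \<le> R b"
      by (auto simp: r_def R_def)
  qed
  have Q: "integral (Q e (1 / e)) ?K = 0"
    unfolding Q_def using e(1) by (rule integral_annulus_inverse_cnj_square)
  have "norm (integral T ?K) = norm (integral T ?K - integral (Q e (1 / e)) ?K)"
    by (simp only: Q diff_zero)
  also have "\<dots> \<le> (\<Sum>b\<in>UNIV. 1 / (r b)\<^sup>2 * measure lebesgue (Q (r b) (R b)))"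
  proof (rule norm_integral_diff_le[OF K])
    show "?K absolutely_integrable_on Q e (1 / e)"
    proof (rule absolutely_integrable_inverse_cnj_square)
      have "Q e (1 / e) = cball 1 (1 / e) - ball 1 e"
        by (auto simp: Q_def)
      then show "bounded (Q e (1 / e))" "Q e (1 / e) \<in> sets lebesgue"
        by (auto intro: bounded_diff)
    qed (use e in \<open>auto simp: Q_def\<close>)
    show "Q (r b) (R b) \<in> lmeasurable" for b
      unfolding Q_def using rR[of b] by (intro measure_annulus) auto
    show "norm (?K w) \<le> 1 / (r b)\<^sup>2" if "w \<in> Q (r b) (R b)" for b w
      using rR(1)[of b] that
      by (auto simp: Q_def norm_divide norm_power dist_norm simp flip: complex_cnj_diff intro!: frac_le power_mono)
    show "(T - Q e (1 / e)) \<union> (Q e (1 / e) - T) \<subseteq> (\<Union>b\<in>UNIV. Q (r b) (R b))"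
    proof
      fix w assume w: "w \<in> (T - Q e (1 / e)) \<union> (Q e (1 / e) - T)"
      have "w \<in> Q (r True) (R True) \<or> w \<in> Q (r False) (R False)"
      proof (cases "w \<in> T")
        case True
        with w have T: "norm w \<le> 1 / e" "e * norm w \<le> dist 1 w" "dist 1 w < e \<or> 1 / e < dist 1 w"
          by (auto simp: T_def Q_def)
        show ?thesis
        proof (cases "dist 1 w < e")
          case True
          then have "e * (1 - e) \<le> e * norm w"
            using e tri(1)[of w] by (intro mult_left_mono) auto
          moreover have "e \<le> e / (1 - e)"
            using e by (simp add: field_simps)
          ultimately show ?thesis
            using T(2) True by (auto simp: Q_def r_def R_def)
        next
          case False
          then show ?thesis
            using T tri(2)[of w] by (auto simp: Q_def r_def R_def)
        qed
      next
        case False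
        with w have T: "e \<le> dist 1 w" "dist 1 w \<le> 1 / e" "1 / e < norm w \<or> dist 1 w < e * norm w"
          by (auto simp: T_def Q_def)
        show ?thesis
        proof (cases "1 / e < norm w")
          case True
          then show ?thesis
            using T(2) tri(3)[of w] by (auto simp: Q_def r_def R_def)
        next
          case False
          \<comment> \<open>With \<open>s = dist 1 w\<close> the case assumption gives
            \<open>s < e * (1 + s)\<close>, which is solved for \<open>s\<close>.\<close>
          have "e * norm w \<le> e * (1 + dist 1 w)"
            using e tri(3)[of w] by (intro mult_left_mono) auto
          then have "dist 1 w * (1 - e) \<le> e"
            using False T(3) by (simp add: algebra_simps)
          then have "dist 1 w \<le> e / (1 - e)"
            using e by (simp add: pos_le_divide_eq)
          moreover have "e * (1 - e) \<le> e"
            using e by (simp add: field_simps)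
          ultimately show ?thesis
            using T(1) by (auto simp: Q_def r_def R_def)
        qed
      qed
      then show "w \<in> (\<Union>b\<in>UNIV. Q (r b) (R b))"
        by blast
    qed
  qed auto
  also have "\<dots> = pi * (1 / (1 - e) ^ 4 - 1) + pi * (((1 + e) / (1 - e))\<^sup>2 - 1)"
  proof -
    \<comment> \<open>The maximum \<open>1 / r^2\<close> of the kernel times the area
      \<open>pi * (R^2 - r^2)\<close> depends only on the ratio \<open>R / r\<close>, which tends to
      \<open>1\<close> as \<open>e\<close> tends to \<open>0\<close> for both annuli.\<close>
    have "1 / (r b)\<^sup>2 * measure lebesgue (Q (r b) (R b)) = pi * ((R b / r b)\<^sup>2 - 1)" for b
      unfolding Q_def measure_annulus(2)[OF less_imp_le[OF rR(1)] rR(2)] using rR(1)[of b] by (simp add: field_simps)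
    moreover have "R True / r True = 1 / (1 - e)\<^sup>2" "R False / r False = (1 + e) / (1 - e)"
      using e by (simp_all add: R_def r_def divide_simps power2_eq_square)
    ultimately show ?thesis
      by (simp add: UNIV_bool power_one_over add.commute flip: power_mult)
  qed
  finally show "norm (integral T ?K)
      \<le> pi * (1 / (1 - e) ^ 4 - 1) + pi * (((1 + e) / (1 - e))\<^sup>2 - 1)" .
qed

text \<open>Under \<open>z = a + c / w\<close> with \<open>c = b - a\<close> the Jacobian
  \<open>norm c ^ 2 / norm w ^ 4\<close> cancels every power of \<open>w\<close> in the integrand
  and leaves \<open>1 / (cnj (1 - w))^2\<close>, divided by \<open>norm c ^ 2\<close>. The unbounded
  domain becomes a bounded one, so integrability at infinity comes out of the same
  substitution.\<close>

lemma interaction_integral_bound: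
  fixes a b :: complex and \<epsilon> :: real
  assumes "0 < \<epsilon>" "\<epsilon> < norm (b - a)"
  defines "e \<equiv> \<epsilon> / norm (b - a)"
  shows "(\<lambda>z. 1 / ((z - a)\<^sup>2 * (cnj (z - b))\<^sup>2)) absolutely_integrable_on UNIV - (ball a \<epsilon> \<union> ball b \<epsilon>)"
      (is "?h absolutely_integrable_on ?\<Omega>")
    and "norm (integral (UNIV - (ball a \<epsilon> \<union> ball b \<epsilon>)) (\<lambda>z. 1 / ((z - a)\<^sup>2 * (cnj (z - b))\<^sup>2)))
      \<le> (pi * (1 / (1 - e) ^ 4 - 1) + pi * (((1 + e) / (1 - e))\<^sup>2 - 1)) / (norm (b - a))\<^sup>2"
proof -
  define c where "c = b - a"
  have c: "c \<noteq> 0" "0 < norm c" "b = a + c"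
    using assms(1,2) by (auto simp: c_def)
  then have e: "0 < e" "e < 1" "\<epsilon> = e * norm c"
    using assms(1,2) unfolding e_def c_def[symmetric] by auto
  define T where "T = {w::complex. norm w \<le> 1 / e \<and> e * norm w \<le> dist 1 w}"
  let ?K = "\<lambda>w::complex. 1 / (cnj (1 - w))\<^sup>2"
  have T: "?K absolutely_integrable_on T"
    "norm (integral T ?K) \<le> pi * (1 / (1 - e) ^ 4 - 1) + pi * (((1 + e) / (1 - e))\<^sup>2 - 1)"
    unfolding T_def by (rule norm_integral_inverse_cnj_square_le[OF e(1,2)])+
  have "closed T"
    unfolding T_def by (intro closed_Collect_conj closed_Collect_le continuous_intros)
  \<comment> \<open>The point \<open>w = 0\<close> corresponds to \<open>z\<close> at infinity; it
    is a null set and is put back later.\<close>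
  then have leb: "T - {0} \<in> sets lebesgue"
    by auto
  define g where "g = (\<lambda>w. a + c / w)"
  have der: "(g has_field_derivative - c / w\<^sup>2) (at w within T - {0})" if "w \<in> T - {0}" for w
    unfolding g_def using that by (auto intro!: derivative_eq_intros simp: power2_eq_square)
  have inj: "inj_on g (T - {0})"
    using c(1) by (auto simp: inj_on_def g_def)
  have mem: "g w \<in> ?\<Omega> \<longleftrightarrow> w \<in> T" if "w \<noteq> 0" for w
  proof -
    have "dist a (g w) = norm c / norm w"
      by (simp add: g_def dist_norm norm_divide)
    moreover have "b - g w = c * (w - 1) / w"
      using that by (simp add: g_def c(3) field_simps)
    then have "dist b (g w) = norm c * dist 1 w / norm w"
      by (simp add: dist_norm norm_divide norm_mult norm_minus_commute)
    moreover have "e * norm c \<le> norm c / norm w \<longleftrightarrow> norm w \<le> 1 / e"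
      "e * norm c \<le> norm c * dist 1 w / norm w \<longleftrightarrow> e * norm w \<le> dist 1 w"
      using that c(2) e(1) by (simp_all add: field_simps)
    ultimately show ?thesis
      unfolding T_def by (simp add: e(3) not_less)
  qed
  have im: "g ` (T - {0}) = ?\<Omega>"
  proof (intro equalityI subsetI)
    fix z assume z: "z \<in> ?\<Omega>"
    then have "z \<noteq> a"
      using assms by auto
    then have "z = g (c / (z - a))" "c / (z - a) \<noteq> 0"
      using c(1) by (auto simp: g_def)
    then show "z \<in> g ` (T - {0})"
      using z mem by (metis Diff_iff imageI singletonD)
  qed (use mem in auto)
  have K: "(norm (- c / w\<^sup>2))\<^sup>2 *\<^sub>R ?h (g w) = (1 / (norm c)\<^sup>2) *\<^sub>R ?K w" if "w \<in> T - {0}" for w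
  \<comment> \<open>At \<open>w = 1\<close>, that is \<open>z = b\<close>, both sides are
    \<open>0\<close> because division by zero yields \<open>0\<close>. Elsewhere squared norms are
    written as products with conjugates, which leaves a rational identity in \<open>w\<close> and
    \<open>cnj w\<close>.\<close>
  proof (cases "w = 1")
    case False
    have w: "w \<noteq> 0" "cnj w \<noteq> 0" "1 - cnj w \<noteq> 0" and c': "cnj c \<noteq> 0"
      using that False c(1) by (auto simp: complex_eq_iff)
    have n: "complex_of_real ((norm (- c / w\<^sup>2))\<^sup>2) = c * cnj c / (w\<^sup>2 * (cnj w)\<^sup>2)"
      "complex_of_real ((norm c)\<^sup>2) = c * cnj c"
      unfolding complex_norm_square by (simp_all only: minus_divide_left[symmetric] complex_cnj_divide complex_cnj_power complex_cnj_minus) simp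
    have "?h (g w) = 1 / ((c / w)\<^sup>2 * (cnj c * (1 - cnj w) / cnj w)\<^sup>2)"
      using w by (simp add: g_def c(3) field_simps)
    also have "c * cnj c / (w\<^sup>2 * (cnj w)\<^sup>2) * \<dots> = 1 / (c * cnj c) * ?K w"
      using w c(1) c' by (simp add: divide_simps) (simp add: power2_eq_square algebra_simps)
    finally show ?thesis
      unfolding scaleR_conv_of_real of_real_divide n by simp
  qed (simp add: g_def c(3))
  have neg: "negligible {0::complex}"
    by simp
  have T0: "?K absolutely_integrable_on (T - {0})"
    using T(1) leb by (rule set_integrable_subset) auto
  have T0': "integral (T - {0}) ?K = integral T ?K"
    by (rule integral_subset_negligible) (auto intro: negligible_subset[OF neg])
  have 1: "(\<lambda>w. (1 / (norm c)\<^sup>2) *\<^sub>R ?K w) absolutely_integrable_on (T - {0})"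
    using T0 by (simp add: absolutely_integrable_on_scaleR_iff)
  have 2: "integral (T - {0}) (\<lambda>w. (1 / (norm c)\<^sup>2) *\<^sub>R ?K w) = (1 / (norm c)\<^sup>2) *\<^sub>R integral T ?K"
    by (simp only: integral_cmul T0')
  have 3: "(\<lambda>w. (norm (- c / w\<^sup>2))\<^sup>2 *\<^sub>R ?h (g w)) absolutely_integrable_on (T - {0})"
    using 1 by (subst set_integrable_cong[OF refl refl K])
  have 4: "integral (T - {0}) (\<lambda>w. (norm (- c / w\<^sup>2))\<^sup>2 *\<^sub>R ?h (g w)) = (1 / (norm c)\<^sup>2) *\<^sub>R integral T ?K"
    unfolding 2[symmetric] by (intro integral_cong K)
  have h: "?h absolutely_integrable_on ?\<Omega> \<and> integral ?\<Omega> ?h = (1 / (norm c)\<^sup>2) *\<^sub>R integral T ?K"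
    using has_absolute_integral_change_of_variables_complex[OF leb der inj, of ?h] 3 4 unfolding im by blast
  show "?h absolutely_integrable_on ?\<Omega>"
    using h by blast
  show "norm (integral ?\<Omega> ?h)
      \<le> (pi * (1 / (1 - e) ^ 4 - 1) + pi * (((1 + e) / (1 - e))\<^sup>2 - 1)) / (norm (b - a))\<^sup>2"
    using h T(2) c(2) by (simp add: c_def[symmetric] divide_right_mono)
qed

text \<open>Removing the disks about the other vortices as well changes the two-vortex integral by a
  term of order \<open>\<epsilon>^2\<close>, since \<open>h\<close> is bounded near those
  vortices.\<close>

lemma interaction_integral_tendsto_0:
  fixes a :: "complex ^ 'n"
  assumes distinct: "\<And>j k. j \<noteq> k \<Longrightarrow> a $ j \<noteq> a $ k" and jk: "j \<noteq> k"
  defines "h \<equiv> (\<lambda>z. 1 / ((z - a $ j)\<^sup>2 * (cnj (z - a $ k))\<^sup>2))"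
    and "\<Omega> \<equiv> (\<lambda>\<epsilon>. UNIV - (\<Union>l. ball (a $ l) \<epsilon>))"
  shows "\<forall>\<^sub>F \<epsilon> in at_right 0. h absolutely_integrable_on \<Omega> \<epsilon>"
    and "((\<lambda>\<epsilon>. integral (\<Omega> \<epsilon>) h) \<longlongrightarrow> 0) (at_right 0)"
proof -
  define n where "n = norm (a $ k - a $ j)"
  have n: "0 < n"
    using distinct[OF jk] by (simp add: n_def)
  \<comment> \<open>The least distance between two vortices; the pair \<open>j\<close>,
    \<open>k\<close> makes the set nonempty, so the minimum is attained and positive.\<close>
  define D where "D = Min ((\<lambda>(l, m). dist (a $ l) (a $ m)) ` {(l, m). l \<noteq> m})"
  have D: "D \<le> dist (a $ l) (a $ m)" if "l \<noteq> m" for l m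
    unfolding D_def using that by (intro Min_le) auto
  have "D \<in> (\<lambda>(l, m). dist (a $ l) (a $ m)) ` {(l, m). l \<noteq> m}"
    unfolding D_def using jk by (intro Min_in) auto
  then have Dpos: "0 < D"
    using distinct by auto
  define \<beta> where "\<beta> = (\<lambda>e. (pi * (1 / (1 - e) ^ 4 - 1) + pi * (((1 + e) / (1 - e))\<^sup>2 - 1)) / n\<^sup>2)"
  let ?P = "\<lambda>\<epsilon>. UNIV - (ball (a $ j) \<epsilon> \<union> ball (a $ k) \<epsilon>)"
  let ?bd = "\<lambda>\<epsilon>. \<beta> (\<epsilon> / n) + (\<Sum>l\<in>UNIV - {j, k}. 1 / (D / 2) ^ 4 * (pi * \<epsilon>\<^sup>2))"
  have main: "h absolutely_integrable_on \<Omega> \<epsilon> \<and> norm (integral (\<Omega> \<epsilon>) h) \<le> ?bd \<epsilon>"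
    if \<epsilon>: "0 < \<epsilon>" "\<epsilon> < min n (D / 2)" for \<epsilon>
  proof
    have P: "h absolutely_integrable_on ?P \<epsilon>" "norm (integral (?P \<epsilon>) h) \<le> \<beta> (\<epsilon> / n)"
      unfolding h_def \<beta>_def n_def using \<epsilon> by (intro interaction_integral_bound; simp add: n_def)+
    show \<Omega>: "h absolutely_integrable_on \<Omega> \<epsilon>"
      using P(1) by (rule set_integrable_subset) (auto simp: \<Omega>_def)
    have "norm (integral (\<Omega> \<epsilon>) h - integral (?P \<epsilon>) h)
        \<le> (\<Sum>l\<in>UNIV - {j, k}. 1 / (D / 2) ^ 4 * measure lebesgue (ball (a $ l) \<epsilon>))"
    proof (rule norm_integral_diff_le[OF \<Omega> P(1)])
      fix l z assume l: "l \<in> UNIV - {j, k}" and z: "z \<in> ball (a $ l) \<epsilon>"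
      \<comment> \<open>As \<open>\<epsilon> < D / 2\<close>, a point of the disk about vortex
        \<open>l\<close> keeps distance at least \<open>D / 2\<close> from every other vortex, in
        particular from \<open>j\<close> and \<open>k\<close>.\<close>
      have *: "D / 2 \<le> norm (z - a $ m)" if "m \<noteq> l" for m
        using D[OF that] z \<epsilon>(2) dist_triangle[of "a $ m" "a $ l" z]
        by (simp add: dist_norm norm_minus_commute)
      have "(D / 2) ^ 4 = (D / 2)\<^sup>2 * (D / 2)\<^sup>2"
        by (simp flip: power_add)
      also have "\<dots> \<le> (norm (z - a $ j))\<^sup>2 * (norm (z - a $ k))\<^sup>2"
        using *[of j] *[of k] l Dpos by (intro mult_mono power_mono) auto
      finally show "norm (h z) \<le> 1 / (D / 2) ^ 4"
        using Dpos unfolding h_def norm_divide norm_mult norm_power complex_mod_cnj norm_one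
        by (intro frac_le) auto
    qed (use Dpos in \<open>auto simp: \<Omega>_def\<close>)
    then show "norm (integral (\<Omega> \<epsilon>) h) \<le> ?bd \<epsilon>"
      using P(2) \<epsilon>(1) norm_triangle_sub[of "integral (\<Omega> \<epsilon>) h" "integral (?P \<epsilon>) h"]
      by (simp add: content_ball unit_ball_vol_2)
  qed
  have ev: "\<forall>\<^sub>F \<epsilon> in at_right 0. 0 < \<epsilon> \<and> \<epsilon> < min n (D / 2)"
    unfolding eventually_at_right_field using n Dpos by (intro exI[of _ "min n (D / 2)"]) auto
  show "\<forall>\<^sub>F \<epsilon> in at_right 0. h absolutely_integrable_on \<Omega> \<epsilon>"
    using ev by eventually_elim (use main in blast)
  have \<beta>: "(?bd \<longlongrightarrow> 0) (at_right 0)"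
    unfolding \<beta>_def using n Dpos by (auto intro!: tendsto_eq_intros)
  show "((\<lambda>\<epsilon>. integral (\<Omega> \<epsilon>) h) \<longlongrightarrow> 0) (at_right 0)"
    by (rule Lim_null_comparison[OF _ \<beta>]) (use ev in eventually_elim, use main in blast)
qed

section \<open>From the vanishing gradient to an identity for the squared field\<close>

subsection \<open>Equilibrium configurations\<close>

text \<open>Moving only vortex \<open>j\<close> in direction \<open>v\<close> changes the functional
  at the rate \<open>- 2 * d $ j * (s \<bullet> v)\<close>, where \<open>s\<close> sums
  \<open>d $ k\<close> times \<open>(a $ j - a $ k) / norm (a $ j - a $ k) ^ 2\<close>. Hence
  \<open>s = 0\<close>, and the conjugate of \<open>s\<close> is the sum in question.\<close>

lemma equilibrium_sum:
  fixes a :: "complex ^ 'n" and d :: "real ^ 'n"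
  assumes distinct: "\<And>j k. j \<noteq> k \<Longrightarrow> a $ j \<noteq> a $ k" and d: "d $ j \<noteq> 0" and eq: "in_equilibrium a d"
  shows "(\<Sum>k\<in>UNIV - {j}. complex_of_real (d $ k) / (a $ j - a $ k)) = 0"
proof -
  let ?I = "{(p, q). p \<noteq> q} :: ('n \<times> 'n) set"
  \<comment> \<open>\<open>u p q\<close> is the gradient of \<open>ln (norm x)\<close> at
    \<open>x = a $ p - a $ q\<close>, and \<open>L\<close> is the resulting derivative of the
    functional.\<close>
  define u where "u = (\<lambda>p q. (1 / (norm (a $ p - a $ q))\<^sup>2) *\<^sub>R (a $ p - a $ q))"
  define L where "L = (\<lambda>h :: complex ^ 'n. \<Sum>(p, q)\<in>?I. - (d $ p * d $ q * (u p q \<bullet> (h $ p - h $ q))))"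
  have "((\<lambda>b. d $ p * d $ q * ln (1 / norm (b $ p - b $ q))) has_derivative
      (\<lambda>h. - (d $ p * d $ q * (u p q \<bullet> (h $ p - h $ q))))) (at a)" if "p \<noteq> q" for p q
  proof -
    have ne: "a $ p - a $ q \<noteq> 0"
      using distinct[OF that] by simp
    have "((\<lambda>b. b $ p - b $ q) has_derivative (\<lambda>h. h $ p - h $ q)) (at a)"
      by (intro has_derivative_diff bounded_linear_imp_has_derivative bounded_linear_vec_nth)
    note norm = has_derivative_compose[OF this has_derivative_norm[OF ne]]
    have "((\<lambda>y. d $ p * d $ q * ln (1 / y)) has_real_derivative - (d $ p * d $ q / y)) (at y)" if "0 < y" for y
      using that by (auto intro!: derivative_eq_intros simp: field_simps power2_eq_square)
    note DERIV_compose_FDERIV[OF this norm]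
    moreover have "(h $ p - h $ q) \<bullet> sgn (a $ p - a $ q) * - (d $ p * d $ q / norm (a $ p - a $ q)) =
        - (d $ p * d $ q * (u p q \<bullet> (h $ p - h $ q)))" for h :: "complex ^ 'n"
      by (simp only: u_def sgn_div_norm inner_scaleR_left inner_scaleR_right inner_commute[of "a $ p - a $ q"])
        (simp add: power2_eq_square divide_inverse)
    ultimately show ?thesis
      using ne by simp
  qed
  then have "((\<lambda>b. kirchhoff_onsager b d) has_derivative L) (at a)"
    unfolding kirchhoff_onsager_def L_def by (auto intro!: has_derivative_sum)
  moreover have "((\<lambda>b. kirchhoff_onsager b d) has_derivative (\<lambda>_. 0)) (at a)"
    using eq by (simp add: in_equilibrium_def gderiv_def)
  ultimately have L: "L = (\<lambda>_. 0)"
    by (rule has_derivative_unique)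
  have sums: "(\<Sum>(p, q)\<in>?I. F p q) = (\<Sum>p\<in>UNIV. \<Sum>q\<in>UNIV - {p}. F p q)" for F :: "'n \<Rightarrow> 'n \<Rightarrow> real"
    by (subst sum.Sigma) (auto intro!: sum.cong)
  have swap: "(\<Sum>(p, q)\<in>?I. F p q) = (\<Sum>(p, q)\<in>?I. F q p)" for F :: "'n \<Rightarrow> 'n \<Rightarrow> real"
    by (rule sum.reindex_bij_witness[of _ prod.swap prod.swap]) auto
  \<comment> \<open>Each unordered pair occurs twice; antisymmetry of \<open>u\<close> and the
    exchange of the indices turn the \<open>h $ q\<close> terms into the \<open>h $ p\<close> terms,
    hence the factor \<open>2\<close>.\<close>
  have Leq: "L h = - 2 * (\<Sum>p\<in>UNIV. \<Sum>q\<in>UNIV - {p}. d $ p * d $ q * (u p q \<bullet> h $ p))" for h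
  proof -
    have anti: "u q p = - u p q" for p q
      unfolding u_def by (metis minus_diff_eq norm_minus_commute scaleR_minus_right)
    have "- (d $ p * d $ q * (u p q \<bullet> (h $ p - h $ q))) =
        - (d $ p * d $ q * (u p q \<bullet> h $ p)) + - (d $ q * d $ p * (u q p \<bullet> h $ q))" for p q
      unfolding anti[of p q] by (simp add: inner_diff_right algebra_simps)
    then have "L h = (\<Sum>(p, q)\<in>?I. - (d $ p * d $ q * (u p q \<bullet> h $ p))) +
        (\<Sum>(p, q)\<in>?I. - (d $ q * d $ p * (u q p \<bullet> h $ q)))"
      unfolding L_def case_prod_unfold by (simp only: sum.distrib)
    also have "(\<Sum>(p, q)\<in>?I. - (d $ q * d $ p * (u q p \<bullet> h $ q))) = (\<Sum>(p, q)\<in>?I. - (d $ p * d $ q * (u p q \<bullet> h $ p)))"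
      by (rule swap)
    finally show ?thesis
      by (simp add: sums sum_negf)
  qed
  define s where "s = (\<Sum>k\<in>UNIV - {j}. d $ k *\<^sub>R u j k)"
  have "- 2 * (d $ j * (s \<bullet> v)) = 0" for v
  proof -
    have "(\<Sum>p\<in>UNIV. \<Sum>q\<in>UNIV - {p}. d $ p * d $ q * (u p q \<bullet> axis j v $ p)) =
        (\<Sum>p\<in>UNIV. if p = j then \<Sum>q\<in>UNIV - {p}. d $ p * d $ q * (u p q \<bullet> v) else 0)"
      by (intro sum.cong) (auto simp: axis_def)
    also have "\<dots> = d $ j * (s \<bullet> v)"
      by (simp add: s_def inner_sum_left sum_distrib_left mult.assoc)
    finally show ?thesis
      using Leq[of "axis j v"] by (simp add: L)
  qed
  then have "s \<bullet> s = 0"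
    using d by simp
  then have "cnj s = 0"
    by simp
  \<comment> \<open>Conjugation turns \<open>x / norm x ^ 2\<close> into
    \<open>1 / x\<close>.\<close>
  moreover have "cnj (d $ k *\<^sub>R u j k) = complex_of_real (d $ k) / (a $ j - a $ k)" for k
  proof -
    have "cnj (u j k) = inverse (a $ j - a $ k)"
      unfolding u_def by (simp add: complex_eq_iff cmod_power2)
    then show ?thesis
      by (simp add: scaleR_conv_of_real divide_inverse)
  qed
  ultimately show ?thesis
    by (simp add: s_def)
qed

text \<open>Partial fractions split each mixed product into \<open>t j k + t k j\<close>, where
  \<open>t j k\<close> carries the simple pole at \<open>a $ j\<close>. For fixed \<open>j\<close>
  the sum of \<open>t j k\<close> over \<open>k\<close> is a multiple of the equilibrium sum, so
  only the double poles survive.\<close>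

lemma equilibrium_square:
  fixes a :: "complex ^ 'n" and d :: "real ^ 'n"
  assumes distinct: "\<And>j k. j \<noteq> k \<Longrightarrow> a $ j \<noteq> a $ k"
    and eq: "\<And>j. (\<Sum>k\<in>UNIV - {j}. complex_of_real (d $ k) / (a $ j - a $ k)) = 0"
    and z: "\<And>j. z \<noteq> a $ j"
  shows "(\<Sum>j\<in>UNIV. complex_of_real (d $ j) / (z - a $ j))\<^sup>2 = (\<Sum>j\<in>UNIV. (complex_of_real (d $ j))\<^sup>2 / (z - a $ j)\<^sup>2)"
proof -
  let ?d = "\<lambda>j. complex_of_real (d $ j)"
  define t where "t = (\<lambda>j k. ?d j * ?d k / ((a $ j - a $ k) * (z - a $ j)))"
  have pf: "?d j / (z - a $ j) * (?d k / (z - a $ k)) = t j k + t k j" if "j \<noteq> k" for j k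
  proof -
    have "z - a $ j \<noteq> 0" "z - a $ k \<noteq> 0" "a $ j - a $ k \<noteq> 0" "a $ k - a $ j \<noteq> 0"
      using distinct[OF that] z[of j] z[of k] by auto
    then show ?thesis
      unfolding t_def by (simp add: divide_simps) (simp add: algebra_simps)
  qed
  have t0: "(\<Sum>k\<in>UNIV - {j}. t j k) = 0" for j
  proof -
    have "(\<Sum>k\<in>UNIV - {j}. t j k) = ?d j / (z - a $ j) * (\<Sum>k\<in>UNIV - {j}. ?d k / (a $ j - a $ k))"
      by (simp add: t_def sum_distrib_left mult.commute)
    then show ?thesis
      by (simp add: eq)
  qed
  \<comment> \<open>Exchanging the order of summation groups the \<open>t k j\<close> by their pole
    too, so that \<open>t0\<close> applies to both halves.\<close>
  have "(\<Sum>j\<in>UNIV. \<Sum>k\<in>UNIV - {j}. t k j) = (\<Sum>k\<in>UNIV. \<Sum>j\<in>UNIV - {k}. t k j)"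
    by (subst (1 2) sum.Sigma; (rule sum.reindex_bij_witness[of _ prod.swap prod.swap])?) auto
  then have cross: "(\<Sum>j\<in>UNIV. \<Sum>k\<in>UNIV - {j}. t j k + t k j) = 0"
    by (simp add: sum.distrib t0)
  have "(\<Sum>j\<in>UNIV. ?d j / (z - a $ j))\<^sup>2 = (\<Sum>j\<in>UNIV. \<Sum>k\<in>UNIV. ?d j / (z - a $ j) * (?d k / (z - a $ k)))"
    by (simp add: power2_eq_square sum_product)
  also have "\<dots> = (\<Sum>j\<in>UNIV. (?d j)\<^sup>2 / (z - a $ j)\<^sup>2 + (\<Sum>k\<in>UNIV - {j}. t j k + t k j))"
  proof (rule sum.cong)
    fix j
    show "(\<Sum>k\<in>UNIV. ?d j / (z - a $ j) * (?d k / (z - a $ k))) =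
        (?d j)\<^sup>2 / (z - a $ j)\<^sup>2 + (\<Sum>k\<in>UNIV - {j}. t j k + t k j)"
      unfolding sum.remove[OF finite UNIV_I, of _ j]
      by (intro arg_cong2[of _ _ _ _ "(+)"] sum.cong refl pf) (auto simp: power2_eq_square)
  qed simp
  also have "\<dots> = (\<Sum>j\<in>UNIV. (?d j)\<^sup>2 / (z - a $ j)\<^sup>2) + (\<Sum>j\<in>UNIV. \<Sum>k\<in>UNIV - {j}. t j k + t k j)"
    by (rule sum.distrib)
  finally show ?thesis
    by (simp only: cross add_0_right)
qed

section \<open>Summation of the interactions over all pairs of vortices\<close>

theorem theorem2p3:
  fixes a :: "complex ^ 'n" and d :: "real ^ 'n"
  assumes distinct_positions: "\<And>j k. j \<noteq> k \<Longrightarrow> a $ j \<noteq> a $ k"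
    and nonzero_circulations: "\<And>j. d $ j \<noteq> 0"
    and equilibrium: "in_equilibrium a d"
  shows "((\<lambda>\<epsilon>. correlation_integral \<epsilon> a d) \<longlongrightarrow> 0) (at_right 0)"
proof -
  let ?I = "{(j, k). j \<noteq> k} :: ('n \<times> 'n) set"
  define h where "h = (\<lambda>j k z. 1 / ((z - a $ j)\<^sup>2 * (cnj (z - a $ k))\<^sup>2))"
  define \<Omega> where "\<Omega> = (\<lambda>\<epsilon>. UNIV - (\<Union>l. ball (a $ l) \<epsilon>))"
  define f where "f = (\<lambda>z. norm (\<Sum>j\<in>UNIV. complex_of_real (d $ j) / (z - a $ j)) ^ 4
        - (\<Sum>j\<in>UNIV. (d $ j) ^ 4 / norm (z - a $ j) ^ 4))"
  define c where "c = (\<lambda>j k. (d $ j)\<^sup>2 * (d $ k)\<^sup>2)"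
  \<comment> \<open>Here \<open>f\<close> is the full integrand. When the squared modulus of the sum
    of double poles is expanded, the diagonal terms are exactly the subtracted fourth powers, so
    only pairs \<open>j \<noteq> k\<close> remain; real parts may be taken because \<open>f\<close>
    is real.\<close>
  have f: "f z = (\<Sum>(j, k)\<in>?I. c j k * Re (h j k z))" if z: "\<And>l. z \<noteq> a $ l" for z
  proof -
    let ?q = "\<lambda>j. (complex_of_real (d $ j))\<^sup>2 / (z - a $ j)\<^sup>2"
    have q: "?q j * cnj (?q k) = complex_of_real (c j k) * h j k z" for j k
      by (simp add: c_def h_def)
    have diag: "complex_of_real (c j j) * h j j z = complex_of_real ((d $ j) ^ 4 / norm (z - a $ j) ^ 4)" for j
    proof -
      have "(z - a $ j)\<^sup>2 * (cnj (z - a $ j))\<^sup>2 = complex_of_real (norm (z - a $ j) ^ 4)"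
        by (metis complex_norm_square numeral_Bit0 of_real_power power_add power_mult_distrib power2_eq_square)
      then show ?thesis
        by (simp add: c_def h_def flip: power_add)
    qed
    have "complex_of_real (norm (\<Sum>j\<in>UNIV. complex_of_real (d $ j) / (z - a $ j)) ^ 4) =
        complex_of_real ((norm ((\<Sum>j\<in>UNIV. complex_of_real (d $ j) / (z - a $ j))\<^sup>2))\<^sup>2)"
      by (simp add: norm_power flip: power_mult)
    also have "\<dots> = (\<Sum>j\<in>UNIV. ?q j) * cnj (\<Sum>j\<in>UNIV. ?q j)"
      unfolding complex_norm_square using equilibrium_square[of a d z] distinct_positions z
        equilibrium_sum[OF distinct_positions nonzero_circulations equilibrium] by simp
    also have "\<dots> = (\<Sum>j\<in>UNIV. \<Sum>k\<in>UNIV. complex_of_real (c j k) * h j k z)"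
      by (simp only: cnj_sum sum_product q)
    also have "\<dots> = (\<Sum>j\<in>UNIV. complex_of_real ((d $ j) ^ 4 / norm (z - a $ j) ^ 4) +
        (\<Sum>k\<in>UNIV - {j}. complex_of_real (c j k) * h j k z))"
    proof (intro sum.cong refl)
      fix j
      show "(\<Sum>k\<in>UNIV. complex_of_real (c j k) * h j k z) =
          complex_of_real ((d $ j) ^ 4 / norm (z - a $ j) ^ 4) + (\<Sum>k\<in>UNIV - {j}. complex_of_real (c j k) * h j k z)"
        unfolding sum.remove[OF finite UNIV_I, of _ j] diag ..
    qed
    also have "\<dots> = complex_of_real (\<Sum>j\<in>UNIV. (d $ j) ^ 4 / norm (z - a $ j) ^ 4) +
        (\<Sum>(j, k)\<in>?I. complex_of_real (c j k) * h j k z)"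
      unfolding sum.distrib of_real_sum by (subst sum.Sigma) (auto intro!: arg_cong2[of _ _ _ _ "(+)"] sum.cong)
    finally have "complex_of_real (f z) = (\<Sum>(j, k)\<in>?I. complex_of_real (c j k) * h j k z)"
      by (simp add: f_def)
    then have "f z = Re (\<Sum>(j, k)\<in>?I. complex_of_real (c j k) * h j k z)"
      by (metis Re_complex_of_real)
    then show ?thesis
      by (simp add: Re_sum case_prod_unfold)
  qed
  have lim: "\<forall>\<^sub>F \<epsilon> in at_right 0. h j k absolutely_integrable_on \<Omega> \<epsilon>"
    "((\<lambda>\<epsilon>. integral (\<Omega> \<epsilon>) (h j k)) \<longlongrightarrow> 0) (at_right 0)" if "j \<noteq> k" for j k
    unfolding h_def \<Omega>_def by (rule interaction_integral_tendsto_0[OF distinct_positions that]; assumption)+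
  have "\<forall>\<^sub>F \<epsilon> in at_right 0. \<forall>(j, k)\<in>?I. h j k absolutely_integrable_on \<Omega> \<epsilon>"
    using lim(1) by (intro eventually_ball_finite) auto
  moreover have "\<forall>\<^sub>F \<epsilon> in at_right 0. (0::real) < \<epsilon>"
    by (rule eventually_at_right_less)
  ultimately have "\<forall>\<^sub>F \<epsilon> in at_right 0. (\<Sum>(j, k)\<in>?I. c j k * Re (integral (\<Omega> \<epsilon>) (h j k))) = correlation_integral \<epsilon> a d"
  proof eventually_elim
    case (elim \<epsilon>)
    have z: "z \<noteq> a $ l" if "z \<in> \<Omega> \<epsilon>" for z l
    proof -
      have "\<epsilon> \<le> dist (a $ l) z"
        using that by (auto simp: \<Omega>_def not_less)
      then show ?thesis
        using elim(2) by auto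
    qed
    have Re: "(\<lambda>z. c j k * Re (h j k z)) absolutely_integrable_on \<Omega> \<epsilon>"
      "integral (\<Omega> \<epsilon>) (\<lambda>z. c j k * Re (h j k z)) = c j k * Re (integral (\<Omega> \<epsilon>) (h j k))" if "j \<noteq> k" for j k
    proof -
      have ai: "h j k absolutely_integrable_on \<Omega> \<epsilon>"
        using elim(1) that by auto
      have bl: "bounded_linear (\<lambda>w. c j k * Re w)"
        by (intro bounded_linear_const_mult bounded_linear_Re)
      show "(\<lambda>z. c j k * Re (h j k z)) absolutely_integrable_on \<Omega> \<epsilon>"
        using absolutely_integrable_linear[OF ai bl] by (simp add: comp_def)
      show "integral (\<Omega> \<epsilon>) (\<lambda>z. c j k * Re (h j k z)) = c j k * Re (integral (\<Omega> \<epsilon>) (h j k))"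
        using integral_linear[OF set_lebesgue_integral_eq_integral(1)[OF ai] bl] by (simp add: comp_def)
    qed
    have "(\<lambda>z. \<Sum>p\<in>?I. c (fst p) (snd p) * Re (h (fst p) (snd p) z)) absolutely_integrable_on \<Omega> \<epsilon>"
      using Re(1) by (intro absolutely_integrable_sum) auto
    then have fi: "f absolutely_integrable_on \<Omega> \<epsilon>"
      by (subst set_integrable_cong[OF refl refl f[OF z]]) (auto simp: case_prod_unfold)
    \<comment> \<open>Borel measurability allows the passage from \<open>lborel\<close> to its
      completion and from there to the gauge integral, for which the pair limits are stated.\<close>
    have [measurable]: "f \<in> borel_measurable borel" "\<Omega> \<epsilon> \<in> sets borel"
      unfolding f_def \<Omega>_def by measurable
    have "correlation_integral \<epsilon> a d = (LINT z:\<Omega> \<epsilon>|lborel. f z)"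
      by (simp add: correlation_integral_def f_def \<Omega>_def)
    also have "\<dots> = (LINT z:\<Omega> \<epsilon>|lebesgue. f z)"
      unfolding set_lebesgue_integral_def by (rule integral_completion[symmetric]) measurable
    also have "\<dots> = integral (\<Omega> \<epsilon>) f"
      by (rule set_lebesgue_integral_eq_integral[OF fi])
    also have "\<dots> = integral (\<Omega> \<epsilon>) (\<lambda>z. \<Sum>(j, k)\<in>?I. c j k * Re (h j k z))"
      by (rule integral_cong) (use f z in blast)
    also have "\<dots> = (\<Sum>(j, k)\<in>?I. integral (\<Omega> \<epsilon>) (\<lambda>z. c j k * Re (h j k z)))"
      unfolding case_prod_unfold
      by (rule integral_sum) (use set_lebesgue_integral_eq_integral(1)[OF Re(1)] in auto)
    also have "\<dots> = (\<Sum>(j, k)\<in>?I. c j k * Re (integral (\<Omega> \<epsilon>) (h j k)))"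
    proof (intro sum.cong refl)
      fix p assume "p \<in> ?I"
      then show "(case p of (j, k) \<Rightarrow> integral (\<Omega> \<epsilon>) (\<lambda>z. c j k * Re (h j k z))) =
          (case p of (j, k) \<Rightarrow> c j k * Re (integral (\<Omega> \<epsilon>) (h j k)))"
        using Re(2)[of "fst p" "snd p"] unfolding case_prod_unfold mem_Collect_eq by blast
    qed
    finally show ?case ..
  qed
  moreover have "((\<lambda>\<epsilon>. \<Sum>(j, k)\<in>?I. c j k * Re (integral (\<Omega> \<epsilon>) (h j k))) \<longlongrightarrow> (\<Sum>(j, k)\<in>?I. c j k * Re 0)) (at_right 0)"
    unfolding case_prod_unfold using lim(2) by (intro tendsto_intros) auto
  ultimately show ?thesis
    by (simp add: tendsto_cong)
qed

end
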